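(* Let $\mathbb{F}$ be a field and let $m,n\ge 1$. Let $f_1,\ldots,f_m\in\mathbb{F}\langle X_1,\ldots,X_n\rangle$ be $M_s(\mathbb{F})$-locally directionally linearly dependent for some positive integer $s$ with $$s>\frac{(d+1)(d+2)}{4}\Big(m-1+\sum_{j=1}^m\deg(f_j)\Big)+\frac d2,\qquad\text{where } d=(m-1)\,m!.$$ Then $f_1,\ldots,f_m$ are linearly dependent in $\mathbb{F}\langle X_1,\ldots,X_n\rangle$ over $\mathbb{F}$.
   Context: $\mathbb{F}$ is an arbitrary field. $\mathbb{F}\langle X_1,\ldots,X_n\rangle$ is the free associative unital $\mathbb{F}$-algebra (polynomials in noncommuting variables), and $\deg$ is the total degree, i.e. the maximal length of a word occurring with nonzero coefficient. $M_s(\mathbb{F})$ is the algebra of $s\times s$ matrices over $\mathbb{F}$, acting on $\mathbb{F}^s$. For $p\in\mathbb{F}\langle X_1,\ldots,X_n\rangle$ and $A\in M_s(\mathbb{F})^n$, $p(A)\in M_s(\mathbb{F})$ is the evaluation of $p$ at $X_i=A_i$ (the empty word evaluates to the identity matrix). Polynomials $f_1,\ldots,f_m$ are $M_s(\mathbb{F})$-locally directionally linearly dependent if for every $A\in M_s(\mathbb{F})^n$ and every $v\in\mathbb{F}^s$ the vectors $f_1(A)v,\ldots,f_m(A)v\in\mathbb{F}^s$ are linearly dependent over $\mathbb{F}$, i.e. there are $\alpha_1,\ldots,\alpha_m\in\mathbb{F}$ (possibly depending on $A$ and $v$), not all zero, with $\sum_j\alpha_j f_j(A)v=0$. *)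

theory Defs
  imports "HOL-Analysis.Analysis" "HOL-Library.Poly_Mapping"
begin

text \<open>
  Words form the free monoid under concatenation. With this instance the finitely supported
  functions from words to a ring, under the convolution product of \<^theory>\<open>HOL-Library.Poly_Mapping\<close>,
  are the free associative unital algebra.
\<close>

instantiation list :: (type) monoid_add
begin

definition zero_list :: "'a list" where "zero_list = []"

definition plus_list :: "'a list \<Rightarrow> 'a list \<Rightarrow> 'a list" where "plus_list = (@)"

instance by standard (simp_all add: zero_list_def plus_list_def)

end

type_synonym ('n, 'a) free_alg = "'n list \<Rightarrow>\<^sub>0 'a"

definition nc_scale :: "'a::field \<Rightarrow> ('n, 'a) free_alg \<Rightarrow> ('n, 'a) free_alg" where
  "nc_scale c p = Poly_Mapping.single 0 c * p"

text \<open>The zero polynomial gets degree 0.\<close>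

definition nc_degree :: "('n, 'a::zero) free_alg \<Rightarrow> nat" where
  "nc_degree p = Max (insert 0 (length ` Poly_Mapping.keys p))"

definition word_eval :: "('n \<Rightarrow> 'a::field ^ 's ^ 's) \<Rightarrow> 'n list \<Rightarrow> 'a ^ 's ^ 's" where
  "word_eval A w = foldr (\<lambda>i M. A i ** M) w (mat 1)"

text \<open>Here \<^term>\<open>mat c\<close> is the scalar matrix with diagonal entries \<^term>\<open>c\<close>.\<close>

definition nc_eval :: "('n \<Rightarrow> 'a::field ^ 's ^ 's) \<Rightarrow> ('n, 'a) free_alg \<Rightarrow> 'a ^ 's ^ 's" where
  "nc_eval A p =
     (\<Sum>w\<in>Poly_Mapping.keys p. mat (Poly_Mapping.lookup p w) ** word_eval A w)"

text \<open>
  Linear dependence of a family rather than of a set: repeated members make the family dependent.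
\<close>

definition lin_dependent_family ::
    "('a::field \<Rightarrow> 'v \<Rightarrow> 'v::comm_monoid_add) \<Rightarrow> nat \<Rightarrow> (nat \<Rightarrow> 'v) \<Rightarrow> bool" where
  "lin_dependent_family smul m x \<longleftrightarrow>
     (\<exists>\<alpha>. (\<exists>j\<in>{1..m}. \<alpha> j \<noteq> 0) \<and> (\<Sum>j=1..m. smul (\<alpha> j) (x j)) = 0)"

definition locally_dir_lin_dependent ::
    "'s::finite itself \<Rightarrow> nat \<Rightarrow> (nat \<Rightarrow> ('n, 'a::field) free_alg) \<Rightarrow> bool" where
  "locally_dir_lin_dependent _ m f \<longleftrightarrow>
     (\<forall>(A :: 'n \<Rightarrow> 'a ^ 's ^ 's) (v :: 'a ^ 's).
        lin_dependent_family (*s) m (\<lambda>j. nc_eval A (f j) *v v))"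

end

theory Submission
  imports Defs
begin

text \<open>
  Suppose that the \<open>f\<^sub>j\<close> are linearly independent. Matrices \<open>A\<close> and a vector \<open>v\<close> for which the
  vectors \<open>f\<^sub>j(A)v\<close> are independent are assembled as a direct sum of small blocks, each of which
  excludes one more linear relation.

  One block suffices for one nonzero polynomial \<open>g\<close>: if its degree is at most \<open>D\<close>, then \<open>g(A)v \<noteq> 0\<close>
  for some \<open>A\<close> and \<open>v\<close> of size \<open>\<lfloor>D/2\<rfloor> + 1\<close> (lemma \<open>nonzero_evaluation\<close>). This is the easy half of the
  Amitsur-Levitzki theorem, and the matrices are the usual staircase of matrix units
  \<open>E\<^sub>0\<^sub>0, E\<^sub>0\<^sub>1, E\<^sub>1\<^sub>1, E\<^sub>1\<^sub>2, \<dots>\<close>: the only order in which all of the first \<open>k\<close> of them have a nonzero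
  product is the order listed. A longest word \<open>u\<close> of \<open>g\<close>, of length \<open>k\<close>, dictates which letter
  receives which unit. Over a large field one would multiply the units by independent parameters
  and extract the coefficient of the product of all parameters. Over an arbitrary field parameters
  with the values 0 and 1 do the same job: one evaluates at all subsets of the staircase and uses
  Moebius inversion on the lattice of subsets.

  For several polynomials one adds the \<open>f\<^sub>j\<close> one at a time (lemma \<open>independent_evaluation\<close>). If the
  values of the polynomials added so far are independent and the next one destroys this, the
  relation between the values is unique up to a scalar. The corresponding combination of
  polynomials is not zero, so a further block, disjoint from the earlier ones, makes it
  nonzero and so excludes the relation. With \<open>D\<close> the sum of all degrees this takes at most
  \<open>m (\<lfloor>D/2\<rfloor> + 1)\<close> dimensions, which the assumed bound on \<open>s\<close> provides.
\<close>

section \<open>Evaluation of noncommutative polynomials\<close>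

lemma word_eval_Nil [simp]: "word_eval A [] = mat 1"
  by (simp add: word_eval_def)

lemma word_eval_Cons [simp]: "word_eval A (i # w) = A i ** word_eval A w"
  by (simp add: word_eval_def)

lemma matrix_vector_mult_sum_left:
  "(\<Sum>i\<in>I. M i) *v v = (\<Sum>i\<in>I. M i *v (v :: 'a::field ^ 'n))"
  by (induction I rule: infinite_finite_induct) (simp_all add: matrix_vector_mult_add_rdistrib)

lemma mat_vector_mult: "mat c *v v = c *s (v :: 'a::field ^ 's::finite)"
proof -
  have "(\<Sum>j\<in>UNIV. (if i = j then c else 0) * v $ j) = c * v $ i" for i
    by (simp add: if_distrib [where f = "\<lambda>x. x * _"] cong: if_cong)
  then show ?thesis
    by (simp add: matrix_vector_mult_def mat_def vec_eq_iff)
qed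

lemma nc_eval_vector:
  fixes A :: "'n \<Rightarrow> 'a::field ^ 's::finite ^ 's"
  assumes "finite K" "Poly_Mapping.keys p \<subseteq> K"
  shows "nc_eval A p *v v = (\<Sum>w\<in>K. Poly_Mapping.lookup p w *s (word_eval A w *v v))"
proof -
  have "nc_eval A p *v v
      = (\<Sum>w\<in>Poly_Mapping.keys p. Poly_Mapping.lookup p w *s (word_eval A w *v v))"
    by (simp add: nc_eval_def matrix_vector_mult_sum_left mat_vector_mult
        flip: matrix_vector_mul_assoc)
  also have "\<dots> = (\<Sum>w\<in>K. Poly_Mapping.lookup p w *s (word_eval A w *v v))"
    using assms by (intro sum.mono_neutral_left) (auto simp: in_keys_iff)
  finally show ?thesis .
qed

lemma lookup_nc_scale [simp]:
  "Poly_Mapping.lookup (nc_scale c p) w = c * Poly_Mapping.lookup p w"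
  unfolding nc_scale_def mult_map_scale_conv_mult [symmetric]
  by (simp add: Poly_Mapping.map.rep_eq when_def)

lemma keys_combination_subset:
  "Poly_Mapping.keys (\<Sum>j\<in>J. nc_scale (\<alpha> j) (f j)) \<subseteq> (\<Union>j\<in>J. Poly_Mapping.keys (f j))"
proof
  fix w assume "w \<in> Poly_Mapping.keys (\<Sum>j\<in>J. nc_scale (\<alpha> j) (f j))"
  then have "(\<Sum>j\<in>J. \<alpha> j * Poly_Mapping.lookup (f j) w) \<noteq> 0"
    by (simp add: in_keys_iff lookup_sum)
  then obtain j where "j \<in> J" "\<alpha> j * Poly_Mapping.lookup (f j) w \<noteq> 0"
    by (rule sum.not_neutral_contains_not_neutral)
  then show "w \<in> (\<Union>j\<in>J. Poly_Mapping.keys (f j))"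
    by (auto simp: in_keys_iff)
qed

lemma nc_eval_combination:
  fixes A :: "'n \<Rightarrow> 'a::field ^ 's::finite ^ 's"
  assumes "finite J"
  shows "nc_eval A (\<Sum>j\<in>J. nc_scale (\<alpha> j) (f j)) *v v = (\<Sum>j\<in>J. \<alpha> j *s (nc_eval A (f j) *v v))"
proof -
  define K where "K = (\<Union>j\<in>J. Poly_Mapping.keys (f j))"
  have K: "finite K" using assms by (simp add: K_def)
  have "nc_eval A (\<Sum>j\<in>J. nc_scale (\<alpha> j) (f j)) *v v
      = (\<Sum>w\<in>K. (\<Sum>j\<in>J. \<alpha> j * Poly_Mapping.lookup (f j) w) *s (word_eval A w *v v))"
    using nc_eval_vector [OF K keys_combination_subset [of \<alpha> f J, folded K_def]]
    by (simp add: lookup_sum)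
  also have "\<dots> = (\<Sum>w\<in>K. \<Sum>j\<in>J. \<alpha> j *s (Poly_Mapping.lookup (f j) w *s (word_eval A w *v v)))"
    by (simp add: vec_eq_iff sum_distrib_right mult.assoc)
  also have "\<dots> = (\<Sum>j\<in>J. \<alpha> j *s (\<Sum>w\<in>K. Poly_Mapping.lookup (f j) w *s (word_eval A w *v v)))"
    by (subst sum.swap) (simp add: vec_eq_iff sum_distrib_left mult.assoc)
  also have "\<dots> = (\<Sum>j\<in>J. \<alpha> j *s (nc_eval A (f j) *v v))"
    by (intro sum.cong refl arg_cong [where f = "(*s) _"] nc_eval_vector [symmetric] K)
       (auto simp: K_def)
  finally show ?thesis .
qed

section \<open>Evaluations at direct sums\<close>

text \<open>
  Blocks of a direct sum are modelled inside the fixed index type: matrices and vectors that vanish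
  off the index set of their block, so that a direct sum is an ordinary sum over disjoint blocks.
\<close>

definition supported_on ::
    "'s set \<Rightarrow> ('n \<Rightarrow> 'a::field ^ 's ^ 's) \<Rightarrow> 'a ^ 's \<Rightarrow> bool" where
  "supported_on S A v \<longleftrightarrow>
     (\<forall>i a b. A i $ a $ b \<noteq> 0 \<longrightarrow> a \<in> S \<and> b \<in> S) \<and> (\<forall>a. v $ a \<noteq> 0 \<longrightarrow> a \<in> S)"

lemma supported_on_mono: "supported_on S A v \<Longrightarrow> S \<subseteq> T \<Longrightarrow> supported_on T A v"
  unfolding supported_on_def by blast

lemma supported_on_sum:
  assumes "supported_on S A v" "supported_on T B w"
  shows "supported_on (S \<union> T) (\<lambda>i. A i + B i) (v + w)"
  unfolding supported_on_def
proof (intro conjI allI impI)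
  fix i a b assume "(A i + B i) $ a $ b \<noteq> 0"
  then have "A i $ a $ b \<noteq> 0 \<or> B i $ a $ b \<noteq> 0" by auto
  then show "a \<in> S \<union> T" "b \<in> S \<union> T"
    using assms unfolding supported_on_def by blast+
next
  fix a assume "(v + w) $ a \<noteq> 0"
  then have "v $ a \<noteq> 0 \<or> w $ a \<noteq> 0" by auto
  then show "a \<in> S \<union> T"
    using assms unfolding supported_on_def by blast
qed

text \<open>
  The empty word acts as the identity of the whole space rather than of the block. Evaluations
  therefore leave the block as matrices, but not once they are applied to a vector of the block.
\<close>

lemma word_eval_supported:
  fixes A :: "'n \<Rightarrow> 'a::field ^ 's::finite ^ 's"
  assumes "supported_on S A v" "a \<notin> S"
  shows "(word_eval A w *v v) $ a = 0"
proof (cases w)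
  case Nil
  then show ?thesis using assms by (auto simp: supported_on_def)
next
  case (Cons i w')
  have "A i $ a $ b = 0" for b
    using assms by (auto simp: supported_on_def)
  then show ?thesis
    by (simp add: Cons flip: matrix_vector_mul_assoc) (simp add: matrix_vector_mult_def)
qed

lemma nc_eval_supported:
  fixes A :: "'n \<Rightarrow> 'a::field ^ 's::finite ^ 's"
  assumes "supported_on S A v" "a \<notin> S"
  shows "(nc_eval A p *v v) $ a = 0"
  by (simp add: nc_eval_vector [OF finite_keys order_refl] word_eval_supported [OF assms])

lemma matrix_vector_mult_disjoint:
  fixes M :: "'a::field ^ 's::finite ^ 's"
  assumes "\<And>a b. M $ a $ b \<noteq> 0 \<Longrightarrow> b \<in> S" "\<And>b. v $ b \<noteq> 0 \<Longrightarrow> b \<in> T" "S \<inter> T = {}"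
  shows "M *v v = 0"
proof -
  have "M $ a $ b = 0 \<or> v $ b = 0" for a b
    using assms by blast
  then have "(M *v v) $ a = 0" for a
    unfolding matrix_vector_mult_def by (auto intro!: sum.neutral)
  then show ?thesis
    by (simp add: vec_eq_iff)
qed

lemma word_eval_direct_sum:
  fixes A B :: "'n \<Rightarrow> 'a::field ^ 's::finite ^ 's"
  assumes A: "supported_on S A v" and B: "supported_on T B w" and disj: "S \<inter> T = {}"
  shows "word_eval (\<lambda>i. A i + B i) u *v (v + w) = word_eval A u *v v + word_eval B u *v w"
proof (induction u)
  case Nil
  then show ?case by simp
next
  case (Cons i u)
  have "A i *v (word_eval B u *v w) = 0"
    using A word_eval_supported [OF B, of _ u] disj
    by (intro matrix_vector_mult_disjoint [where S = S and T = T]) (auto simp: supported_on_def)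
  moreover have "B i *v (word_eval A u *v v) = 0"
    using B word_eval_supported [OF A, of _ u] disj
    by (intro matrix_vector_mult_disjoint [where S = T and T = S]) (auto simp: supported_on_def)
  moreover have "word_eval (\<lambda>i. A i + B i) (i # u) *v (v + w)
      = (A i + B i) *v (word_eval A u *v v + word_eval B u *v w)"
    by (simp only: word_eval_Cons Cons flip: matrix_vector_mul_assoc)
  ultimately show ?case
    by (simp add: matrix_vector_right_distrib matrix_vector_mult_add_rdistrib
        flip: matrix_vector_mul_assoc)
qed

lemma nc_eval_direct_sum:
  fixes A B :: "'n \<Rightarrow> 'a::field ^ 's::finite ^ 's"
  assumes "supported_on S A v" "supported_on T B w" "S \<inter> T = {}"
  shows "nc_eval (\<lambda>i. A i + B i) p *v (v + w) = nc_eval A p *v v + nc_eval B p *v w"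
  by (simp add: nc_eval_vector [OF finite_keys order_refl] word_eval_direct_sum [OF assms]
      vector_add_ldistrib sum.distrib)

text \<open>
  The values in the two blocks have disjoint supports and cannot cancel.
\<close>

lemma nc_eval_direct_sum_eq_0:
  fixes A B :: "'n \<Rightarrow> 'a::field ^ 's::finite ^ 's"
  assumes A: "supported_on S A v" and B: "supported_on T B w" and disj: "S \<inter> T = {}"
    and eq: "nc_eval (\<lambda>i. A i + B i) p *v (v + w) = 0"
  shows "nc_eval A p *v v = 0" "nc_eval B p *v w = 0"
proof -
  have sum: "(nc_eval A p *v v) $ a + (nc_eval B p *v w) $ a = 0" for a
    using eq by (simp add: nc_eval_direct_sum [OF A B disj] vec_eq_iff)
  have "(nc_eval A p *v v) $ a = 0 \<and> (nc_eval B p *v w) $ a = 0" for a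
    using sum [of a] nc_eval_supported [OF A, of a p] nc_eval_supported [OF B, of a p] disj
    by (metis add.left_neutral add.right_neutral disjoint_iff)
  then show "nc_eval A p *v v = 0" "nc_eval B p *v w = 0"
    by (simp_all add: vec_eq_iff)
qed

section \<open>The staircase\<close>

text \<open>
  The staircase is the directed graph on the naturals in which edge \<open>p\<close> runs from \<open>p div 2\<close> to
  \<open>(p + 1) div 2\<close>: the even edges are loops, the odd ones lead to the next vertex. Walks are lists
  of edges.
\<close>

fun walk :: "nat \<Rightarrow> nat list \<Rightarrow> nat \<Rightarrow> bool" where
  "walk a [] b \<longleftrightarrow> a = b"
| "walk a (p # ps) b \<longleftrightarrow> a = p div 2 \<and> walk ((p + 1) div 2) ps b"

text \<open>
  The edges that leave the endpoint of \<open>p\<close> are \<open>p\<close> and \<open>p + 1\<close> for even \<open>p\<close>, and \<open>p + 1\<close> and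
  \<open>p + 2\<close> for odd \<open>p\<close>: edge numbers never decrease along a walk.
\<close>

lemma walk_sorted: "walk a ps b \<Longrightarrow> sorted ps \<and> (\<forall>p\<in>set ps. a \<le> p div 2)"
proof (induction ps arbitrary: a)
  case Nil
  then show ?case by simp
next
  case (Cons p ps)
  then have IH: "sorted ps" "\<forall>q\<in>set ps. (p + 1) div 2 \<le> q div 2" and a: "a = p div 2"
    by auto
  have "p \<le> q" if "(p + 1) div 2 \<le> q div 2" for q
    using that by presburger
  moreover have "p div 2 \<le> q div 2" if "(p + 1) div 2 \<le> q div 2" for q
    using that by presburger
  ultimately show ?case using IH a by auto
qed

lemma walk_upt: "i \<le> k \<Longrightarrow> walk (i div 2) [i..<k] (k div 2)"
  by (induction i rule: inc_induct) (simp_all add: upt_conv_Cons)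

text \<open>
  Sortedness makes the Eulerian walk through the first \<open>k\<close> edges unique. This is what isolates one
  single coefficient of the polynomial.
\<close>

lemma walk_covering_iff:
  assumes "length ps \<le> k"
  shows "walk 0 ps (k div 2) \<and> set ps = {..<k} \<longleftrightarrow> ps = [0..<k]"
proof
  assume ps: "walk 0 ps (k div 2) \<and> set ps = {..<k}"
  then have "distinct ps"
    using assms by (metis card_length card_lessThan card_distinct le_antisym)
  then show "ps = [0..<k]"
    using ps walk_sorted
    by (intro sorted_distinct_set_unique) (auto simp: atLeast0LessThan)
next
  assume "ps = [0..<k]"
  then show "walk 0 ps (k div 2) \<and> set ps = {..<k}"
    using walk_upt [of 0 k] by (auto simp: atLeast0LessThan)
qed

text \<open>
  The letter in position \<open>p\<close> of \<open>u\<close> receives the matrix unit of edge \<open>p\<close>. The set \<open>P\<close> selects the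
  edges that are present, and \<open>c\<close> places the vertices of the graph among the matrix indices.
\<close>

definition staircase :: "'n list \<Rightarrow> (nat \<Rightarrow> 's) \<Rightarrow> nat set \<Rightarrow> 'n \<Rightarrow> 'a::field ^ 's ^ 's" where
  "staircase u c P i =
     (\<chi> a b. \<Sum>p\<in>{p\<in>P. u ! p = i}. if a = c (p div 2) \<and> b = c ((p + 1) div 2) then 1 else 0)"

lemma staircase_vector:
  fixes x :: "'a::field ^ 's::finite"
  assumes c: "inj_on c {..k div 2}" and P: "P \<subseteq> {..<k}" and a: "a \<le> k div 2"
  shows "(staircase u c P i *v x) $ c a
       = (\<Sum>p\<in>{p\<in>P. u ! p = i \<and> p div 2 = a}. x $ c ((p + 1) div 2))"
proof -
  have fin: "finite P" using P finite_subset by blast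
  have "(staircase u c P i *v x) $ c a
      = (\<Sum>b\<in>UNIV. \<Sum>p\<in>{p\<in>P. u ! p = i}.
          if c a = c (p div 2) \<and> b = c ((p + 1) div 2) then x $ b else 0)"
    by (auto simp: staircase_def matrix_vector_mult_def sum_distrib_right intro!: sum.cong)
  also have "\<dots> = (\<Sum>p\<in>{p\<in>P. u ! p = i}. \<Sum>b\<in>UNIV.
          if b = c ((p + 1) div 2) then (if c a = c (p div 2) then x $ b else 0) else 0)"
    by (subst sum.swap) (auto intro!: sum.cong)
  also have "\<dots> = (\<Sum>p\<in>{p\<in>P. u ! p = i}. if c a = c (p div 2) then x $ c ((p + 1) div 2) else 0)"
    by (intro sum.cong refl) simp
  also have "\<dots> = (\<Sum>p\<in>{p\<in>P. u ! p = i}. if p div 2 = a then x $ c ((p + 1) div 2) else 0)"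
  proof (intro sum.cong refl)
    fix p assume "p \<in> {p\<in>P. u ! p = i}"
    then have "p div 2 \<in> {..k div 2}"
      using P by (auto intro: div_le_mono)
    then have "c a = c (p div 2) \<longleftrightarrow> p div 2 = a"
      using a inj_on_eq_iff [OF c, of a "p div 2"] by auto
    then show "(if c a = c (p div 2) then x $ c ((p + 1) div 2) else 0)
             = (if p div 2 = a then x $ c ((p + 1) div 2) else 0)"
      by simp
  qed
  also have "\<dots> = (\<Sum>p\<in>{p\<in>P. u ! p = i \<and> p div 2 = a}. x $ c ((p + 1) div 2))"
    using fin by (simp add: sum.inter_filter [symmetric] conj_assoc)
  finally show ?thesis .
qed

text \<open>
  As with powers of an adjacency matrix, entries of word evaluations count walks, here the walks
  whose edges carry the letters of the word.
\<close>

lemma word_eval_staircase: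
  assumes c: "inj_on c {..k div 2}" and P: "P \<subseteq> {..<k}" and a: "a \<le> k div 2" and b: "b \<le> k div 2"
  shows "(word_eval (staircase u c P) w *v axis (c b) (1 :: 'a::field)) $ (c a :: 's::finite)
       = of_nat (card {ps. walk a ps b \<and> set ps \<subseteq> P \<and> map ((!) u) ps = w})"
  using a
proof (induction w arbitrary: a)
  case Nil
  have "{ps. walk a ps b \<and> set ps \<subseteq> P \<and> map ((!) u) ps = []} = (if a = b then {[]} else {})"
    by auto
  then show ?case
    using inj_on_eq_iff [OF c, of a b] Nil b by (simp add: axis_def)
next
  case (Cons i w)
  define W where "W a = {ps. walk a ps b \<and> set ps \<subseteq> P \<and> map ((!) u) ps = w}" for a
  define Q where "Q = {p\<in>P. u ! p = i \<and> p div 2 = a}"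
  have fin: "finite P" using P finite_subset by blast
  then have Q: "finite Q" by (simp add: Q_def)
  have W: "finite (W a)" for a
    by (rule finite_subset [OF _ finite_lists_length_eq [OF fin, of "length w"]])
       (auto simp: W_def)
  have step: "(p + 1) div 2 \<le> k div 2" if "p \<in> Q" for p
    using that P by (intro div_le_mono) (auto simp: Q_def)
  have "{ps. walk a ps b \<and> set ps \<subseteq> P \<and> map ((!) u) ps = i # w}
      = (\<Union>p\<in>Q. (#) p ` W ((p + 1) div 2))"
  proof (intro equalityI subsetI)
    fix ps assume "ps \<in> {ps. walk a ps b \<and> set ps \<subseteq> P \<and> map ((!) u) ps = i # w}"
    then show "ps \<in> (\<Union>p\<in>Q. (#) p ` W ((p + 1) div 2))"
      by (cases ps) (auto simp: Q_def W_def)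
  qed (auto simp: Q_def W_def)
  then have "card {ps. walk a ps b \<and> set ps \<subseteq> P \<and> map ((!) u) ps = i # w}
      = card (\<Union>p\<in>Q. (#) p ` W ((p + 1) div 2))"
    by simp
  also have "\<dots> = (\<Sum>p\<in>Q. card (W ((p + 1) div 2)))"
    using Q W by (subst card_UN_disjoint) (auto simp: card_image)
  finally have card: "card {ps. walk a ps b \<and> set ps \<subseteq> P \<and> map ((!) u) ps = i # w}
      = (\<Sum>p\<in>Q. card (W ((p + 1) div 2)))" .
  have "(word_eval (staircase u c P) (i # w) *v axis (c b) (1::'a)) $ c a
      = (\<Sum>p\<in>Q. (word_eval (staircase u c P) w *v axis (c b) 1) $ c ((p + 1) div 2))"
    using staircase_vector [OF c P Cons.prems, of u i]
    by (simp add: Q_def flip: matrix_vector_mul_assoc)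
  also have "\<dots> = (\<Sum>p\<in>Q. of_nat (card (W ((p + 1) div 2))))"
    using Cons.IH [OF step] by (intro sum.cong refl) (simp add: W_def)
  finally show ?case by (simp add: card)
qed

text \<open>
  Summing over the words of \<open>g\<close> turns the count into a sum over walks in which \<open>P\<close> enters only
  through the condition \<open>set ps \<subseteq> P\<close>, as Moebius inversion requires.
\<close>

lemma nc_eval_staircase:
  assumes c: "inj_on c {..k div 2}" and P: "P \<subseteq> {..<k}"
    and g: "\<And>w. w \<in> Poly_Mapping.keys g \<Longrightarrow> length w \<le> k"
    and W: "W = {ps. walk 0 ps (k div 2) \<and> set ps \<subseteq> {..<k} \<and> length ps \<le> k}"
  shows "(nc_eval (staircase u c P) g *v axis (c (k div 2)) (1 :: 'a::field)) $ (c 0 :: 's::finite)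
       = (\<Sum>ps\<in>{ps\<in>W. set ps \<subseteq> P}. Poly_Mapping.lookup g (map ((!) u) ps))"
proof -
  define V where "V w = {ps. walk 0 ps (k div 2) \<and> set ps \<subseteq> P \<and> map ((!) u) ps = w}" for w
  have W_fin: "finite W"
    unfolding W by (rule finite_subset [OF _ finite_lists_length_le [of "{..<k}" k]]) auto
  have V_sub: "V w \<subseteq> {ps\<in>W. set ps \<subseteq> P}" if "w \<in> Poly_Mapping.keys g" for w
    using g [OF that] P by (auto simp: V_def W)
  have V_fin: "finite (V w)" if "w \<in> Poly_Mapping.keys g" for w
    by (rule finite_subset [OF V_sub [OF that]]) (simp add: W_fin)
  have "(nc_eval (staircase u c P) g *v axis (c (k div 2)) 1) $ c 0
      = (\<Sum>w\<in>Poly_Mapping.keys g. Poly_Mapping.lookup g w * of_nat (card (V w)))"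
    by (simp add: nc_eval_vector [OF finite_keys order_refl] word_eval_staircase [OF c P] V_def)
  also have "\<dots> = (\<Sum>w\<in>Poly_Mapping.keys g. \<Sum>ps\<in>V w. Poly_Mapping.lookup g (map ((!) u) ps))"
    by (intro sum.cong refl) (simp add: V_def mult.commute)
  also have "\<dots> = (\<Sum>ps\<in>(\<Union>w\<in>Poly_Mapping.keys g. V w). Poly_Mapping.lookup g (map ((!) u) ps))"
    using V_fin by (subst sum.UNION_disjoint) (auto simp: V_def)
  also have "\<dots> = (\<Sum>ps\<in>{ps\<in>W. set ps \<subseteq> P}. Poly_Mapping.lookup g (map ((!) u) ps))"
  proof (intro sum.mono_neutral_left)
    show "(\<Union>w\<in>Poly_Mapping.keys g. V w) \<subseteq> {ps\<in>W. set ps \<subseteq> P}"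
      using V_sub by blast
    show "\<forall>ps\<in>{ps\<in>W. set ps \<subseteq> P} - (\<Union>w\<in>Poly_Mapping.keys g. V w).
        Poly_Mapping.lookup g (map ((!) u) ps) = 0"
      by (auto simp: V_def W in_keys_iff)
  qed (simp add: W_fin)
  finally show ?thesis .
qed

text \<open>
  Moebius inversion on the lattice of subsets, in the case of vanishing sums. It replaces the choice
  of generic scalars, so that finite fields need no separate treatment.
\<close>

lemma sum_fibre_eq_0:
  fixes h :: "'b \<Rightarrow> 'a::ab_group_add"
  assumes W: "finite W" and Q: "finite Q"
    and zero: "\<And>P. P \<subseteq> Q \<Longrightarrow> (\<Sum>x\<in>{x\<in>W. s x \<subseteq> P}. h x) = 0"
  shows "(\<Sum>x\<in>{x\<in>W. s x = Q}. h x) = 0"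
  using Q zero
proof (induction Q rule: finite_psubset_induct)
  case (psubset Q)
  have "(\<Sum>x\<in>{x\<in>W. s x \<subseteq> Q}. h x) = (\<Sum>R\<in>Pow Q. \<Sum>x\<in>{x \<in> {x\<in>W. s x \<subseteq> Q}. s x = R}. h x)"
    using W psubset.hyps by (intro sum.group [symmetric]) auto
  also have "\<dots> = (\<Sum>R\<in>Pow Q. \<Sum>x\<in>{x\<in>W. s x = R}. h x)"
    by (intro sum.cong) auto
  also have "\<dots> = (\<Sum>R\<in>{Q}. \<Sum>x\<in>{x\<in>W. s x = R}. h x)"
  proof (rule sum.mono_neutral_right)
    show "\<forall>R\<in>Pow Q - {Q}. (\<Sum>x\<in>{x\<in>W. s x = R}. h x) = 0"
    proof
      fix R assume "R \<in> Pow Q - {Q}"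
      then have "R \<subset> Q" by auto
      then show "(\<Sum>x\<in>{x\<in>W. s x = R}. h x) = 0"
        by (intro psubset.IH psubset.prems) auto
    qed
  qed (use psubset.hyps in auto)
  finally show ?case using psubset.prems by simp
qed

text \<open>
  If every subset of the first \<open>k\<close> edges gave the value 0, then by inversion so would the walks that
  use all \<open>k\<close> edges. Walks of length at most \<open>k\<close> with this property reduce to the Eulerian one, which
  spells the word \<open>u\<close> and contributes its nonzero coefficient.
\<close>

lemma nonzero_evaluation:
  fixes g :: "('n, 'a::field) free_alg" and T :: "'s::finite set"
  assumes "g \<noteq> 0" and deg: "\<And>w. w \<in> Poly_Mapping.keys g \<Longrightarrow> length w \<le> D"
    and T: "D div 2 < card T"
  obtains A :: "'n \<Rightarrow> 'a ^ 's ^ 's" and v :: "'a ^ 's"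
  where "supported_on T A v" "nc_eval A g *v v \<noteq> 0"
proof -
  define k where "k = Max (length ` Poly_Mapping.keys g)"
  have ne: "Poly_Mapping.keys g \<noteq> {}" using \<open>g \<noteq> 0\<close> by simp
  then have "k \<in> length ` Poly_Mapping.keys g"
    unfolding k_def by (intro Max_in) auto
  then obtain u where u: "u \<in> Poly_Mapping.keys g" "length u = k" by auto
  have k: "length w \<le> k" if "w \<in> Poly_Mapping.keys g" for w
    using that by (simp add: k_def)
  have "k \<le> D" using deg u by blast
  then have "card {..k div 2} \<le> card T"
    using T div_le_mono [of k D 2] by simp
  then obtain c where c: "c ` {..k div 2} \<subseteq> T" "inj_on c {..k div 2}"
    using card_le_inj [of "{..k div 2}" T] by auto
  define W where "W = {ps. walk 0 ps (k div 2) \<and> set ps \<subseteq> {..<k} \<and> length ps \<le> k}"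
  have W_fin: "finite W"
    unfolding W_def by (rule finite_subset [OF _ finite_lists_length_le [of "{..<k}" k]]) auto
  have "\<exists>P\<subseteq>{..<k}. nc_eval (staircase u c P) g *v axis (c (k div 2)) (1 :: 'a) \<noteq> 0"
  proof (rule ccontr)
    assume "\<not> ?thesis"
    then have "(\<Sum>ps\<in>{ps\<in>W. set ps \<subseteq> P}. Poly_Mapping.lookup g (map ((!) u) ps)) = 0"
      if "P \<subseteq> {..<k}" for P
      using that nc_eval_staircase [where g = g and u = u, OF c(2) that k W_def] by auto
    then have "(\<Sum>ps\<in>{ps\<in>W. set ps = {..<k}}. Poly_Mapping.lookup g (map ((!) u) ps)) = 0"
      by (rule sum_fibre_eq_0 [OF W_fin finite_lessThan])
    moreover have "{ps\<in>W. set ps = {..<k}} = {[0..<k]}"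
    proof -
      have "ps \<in> W \<and> set ps = {..<k} \<longleftrightarrow> ps = [0..<k]" for ps
        using walk_covering_iff [of ps k] by (cases "length ps \<le> k") (auto simp: W_def)
      then show ?thesis by blast
    qed
    ultimately have "Poly_Mapping.lookup g (map ((!) u) [0..<k]) = 0" by simp
    then show False using u by (auto simp: map_nth in_keys_iff)
  qed
  then obtain P where P: "P \<subseteq> {..<k}"
    and nz: "nc_eval (staircase u c P) g *v axis (c (k div 2)) (1 :: 'a) \<noteq> 0" by blast
  have "supported_on T (staircase u c P) (axis (c (k div 2)) (1 :: 'a))"
    unfolding supported_on_def
  proof (intro conjI allI impI)
    fix i and a b :: 's
    assume "(staircase u c P i :: 'a ^ 's ^ 's) $ a $ b \<noteq> 0"
    then obtain p where "p \<in> P" "a = c (p div 2)" "b = c ((p + 1) div 2)"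
      unfolding staircase_def vec_lambda_beta
      by (elim sum.not_neutral_contains_not_neutral) (auto split: if_splits)
    moreover have "p div 2 \<le> k div 2" "(p + 1) div 2 \<le> k div 2" if "p \<in> P" for p
      using P that by (auto intro!: div_le_mono)
    ultimately show "a \<in> T" "b \<in> T" using c(1) by auto
  next
    fix a :: 's
    assume "axis (c (k div 2)) (1 :: 'a) $ a \<noteq> 0"
    then show "a \<in> T" using c(1) by (auto simp: axis_def split: if_splits)
  qed
  then show ?thesis using nz that by blast
qed

section \<open>Independent values\<close>

text \<open>
  Independence over an arbitrary index set permits induction on the index set.
\<close>

definition lin_independent_on ::
    "('a::field \<Rightarrow> 'v \<Rightarrow> 'v::comm_monoid_add) \<Rightarrow> nat set \<Rightarrow> (nat \<Rightarrow> 'v) \<Rightarrow> bool" where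
  "lin_independent_on smul J x \<longleftrightarrow>
     (\<forall>\<alpha>. (\<Sum>j\<in>J. smul (\<alpha> j) (x j)) = 0 \<longrightarrow> (\<forall>j\<in>J. \<alpha> j = 0))"

lemma lin_dependent_family_iff:
  "lin_dependent_family smul m x \<longleftrightarrow> \<not> lin_independent_on smul {1..m} x"
  unfolding lin_dependent_family_def lin_independent_on_def by blast

text \<open>
  One more vector adds at most one dimension of relations: the coefficient of \<open>\<alpha>\<close> at the new index is
  nonzero, and subtracting a multiple of \<open>\<alpha>\<close> from \<open>\<beta>\<close> leaves a relation between independent vectors.
\<close>

lemma relation_unique:
  fixes x :: "nat \<Rightarrow> 'a::field ^ 's::finite"
  assumes J: "finite J" "j \<notin> J" and indep: "lin_independent_on (*s) J x"
    and \<alpha>: "(\<Sum>i\<in>insert j J. \<alpha> i *s x i) = 0" "\<exists>i\<in>insert j J. \<alpha> i \<noteq> 0"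
    and \<beta>: "(\<Sum>i\<in>insert j J. \<beta> i *s x i) = 0"
  shows "\<exists>c. \<forall>i\<in>insert j J. \<beta> i = c * \<alpha> i"
proof -
  have "\<alpha> j \<noteq> 0"
  proof
    assume "\<alpha> j = 0"
    then have "(\<Sum>i\<in>J. \<alpha> i *s x i) = 0" using \<alpha>(1) J by simp
    then have "\<forall>i\<in>J. \<alpha> i = 0" using indep by (simp add: lin_independent_on_def)
    then show False using \<alpha>(2) \<open>\<alpha> j = 0\<close> by auto
  qed
  define c where "c = \<beta> j / \<alpha> j"
  have j: "\<beta> j - c * \<alpha> j = 0" using \<open>\<alpha> j \<noteq> 0\<close> by (simp add: c_def)
  have "(\<Sum>i\<in>insert j J. (\<beta> i - c * \<alpha> i) *s x i)
      = (\<Sum>i\<in>insert j J. \<beta> i *s x i) - c *s (\<Sum>i\<in>insert j J. \<alpha> i *s x i)"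
    by (simp only: vec_eq_iff sum_component vector_smult_component vector_minus_component
        sum_distrib_left left_diff_distrib sum_subtractf mult.assoc simp_thms)
  then have "(\<Sum>i\<in>insert j J. (\<beta> i - c * \<alpha> i) *s x i) = 0"
    using \<alpha>(1) \<beta> by simp
  then have "(\<Sum>i\<in>J. (\<beta> i - c * \<alpha> i) *s x i) = 0" using J j by simp
  then have "\<forall>i\<in>J. \<beta> i - c * \<alpha> i = 0"
    using indep [unfolded lin_independent_on_def, rule_format, of "\<lambda>i. \<beta> i - c * \<alpha> i"]
    by blast
  then show ?thesis using j by auto
qed

text \<open>
  Each new index reserves a block \<open>T\<close> of \<open>D div 2 + 1\<close> matrix indices. The combination of the \<open>f\<^sub>j\<close>
  given by the only candidate relation is nonzero on a suitable choice in \<open>T\<close>, whereas any relation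
  of the direct sum holds in both blocks.
\<close>

lemma independent_evaluation:
  fixes f :: "nat \<Rightarrow> ('n, 'a::field) free_alg" and S :: "'s::finite set"
  assumes "finite J"
    and "\<And>j w. j \<in> J \<Longrightarrow> w \<in> Poly_Mapping.keys (f j) \<Longrightarrow> length w \<le> D"
    and "lin_independent_on nc_scale J f"
    and "card J * (D div 2 + 1) \<le> card S"
  shows "\<exists>(A :: 'n \<Rightarrow> 'a ^ 's ^ 's) v.
     supported_on S A v \<and> lin_independent_on (*s) J (\<lambda>j. nc_eval A (f j) *v v)"
  using assms
proof (induction J arbitrary: S rule: finite_induct)
  case empty
  have "supported_on S (\<lambda>_::'n. 0 :: 'a ^ 's ^ 's) 0" by (simp add: supported_on_def)
  then show ?case by (auto simp: lin_independent_on_def)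
next
  case (insert j J S)
  have "D div 2 + 1 \<le> card S" using insert by simp
  then obtain T where T: "T \<subseteq> S" "card T = D div 2 + 1"
    by (meson obtain_subset_with_card_n)
  have S_T: "card J * (D div 2 + 1) \<le> card (S - T)"
    using insert.prems(3) insert.hyps T by (simp add: card_Diff_subset)
  have f_J: "lin_independent_on nc_scale J f"
    unfolding lin_independent_on_def
  proof (intro allI impI ballI)
    fix \<alpha> i assume sum: "(\<Sum>j\<in>J. nc_scale (\<alpha> j) (f j)) = 0" and i: "i \<in> J"
    have "nc_scale 0 (f j) = 0" by (simp add: nc_scale_def)
    moreover have "(\<Sum>i\<in>J. nc_scale ((\<alpha>(j := 0)) i) (f i)) = (\<Sum>j\<in>J. nc_scale (\<alpha> j) (f j))"
      using insert.hyps by (intro sum.cong) auto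
    ultimately have "(\<Sum>i\<in>insert j J. nc_scale ((\<alpha>(j := 0)) i) (f i)) = 0"
      using insert.hyps sum by simp
    then have "\<forall>i\<in>insert j J. (\<alpha>(j := 0)) i = 0"
      using insert.prems(2) unfolding lin_independent_on_def by blast
    moreover have "i \<noteq> j" using i insert.hyps by blast
    ultimately show "\<alpha> i = 0" using i by auto
  qed
  have "\<exists>(A :: 'n \<Rightarrow> 'a ^ 's ^ 's) v.
     supported_on (S - T) A v \<and> lin_independent_on (*s) J (\<lambda>j. nc_eval A (f j) *v v)"
    using insert.prems(1) by (intro insert.IH f_J S_T) blast
  then obtain A :: "'n \<Rightarrow> 'a ^ 's ^ 's" and v where A: "supported_on (S - T) A v"
    and indep: "lin_independent_on (*s) J (\<lambda>j. nc_eval A (f j) *v v)" by blast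
  show ?case
  proof (cases "lin_independent_on (*s) (insert j J) (\<lambda>j. nc_eval A (f j) *v v)")
    case True
    then show ?thesis using supported_on_mono [OF A Diff_subset] by blast
  next
    case False
    then obtain \<alpha> where \<alpha>: "(\<Sum>i\<in>insert j J. \<alpha> i *s (nc_eval A (f i) *v v)) = 0"
      "\<exists>i\<in>insert j J. \<alpha> i \<noteq> 0"
      unfolding lin_independent_on_def by blast
    \<comment> \<open>At \<open>A\<close> and \<open>v\<close> the combination for \<open>\<alpha>\<close> vanishes, but as a polynomial it does not.\<close>
    define comb where "comb \<beta> = (\<Sum>i\<in>insert j J. nc_scale (\<beta> i) (f i))" for \<beta>
    have eval_comb: "nc_eval B (comb \<beta>) *v w = (\<Sum>i\<in>insert j J. \<beta> i *s (nc_eval B (f i) *v w))"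
      for B :: "'n \<Rightarrow> 'a ^ 's ^ 's" and \<beta> w
      unfolding comb_def using insert.hyps(1) by (intro nc_eval_combination) simp
    have "comb \<alpha> \<noteq> 0"
      using insert.prems(2) \<alpha>(2) unfolding lin_independent_on_def comb_def by blast
    moreover have "length w \<le> D" if "w \<in> Poly_Mapping.keys (comb \<alpha>)" for w
      using that insert.prems(1) keys_combination_subset [of \<alpha> f "insert j J"]
      unfolding comb_def by blast
    moreover have "D div 2 < card T" using T by simp
    ultimately obtain B :: "'n \<Rightarrow> 'a ^ 's ^ 's" and w where B: "supported_on T B w"
      and nz: "nc_eval B (comb \<alpha>) *v w \<noteq> 0"
      by (rule nonzero_evaluation)
    have disj: "(S - T) \<inter> T = {}" by blast
    have "lin_independent_on (*s) (insert j J) (\<lambda>j. nc_eval (\<lambda>i. A i + B i) (f j) *v (v + w))"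
      unfolding lin_independent_on_def
    proof (intro allI impI)
      fix \<beta>
      assume "(\<Sum>i\<in>insert j J. \<beta> i *s (nc_eval (\<lambda>i. A i + B i) (f i) *v (v + w))) = 0"
      then have "nc_eval (\<lambda>i. A i + B i) (comb \<beta>) *v (v + w) = 0"
        by (simp only: eval_comb)
      note zero = nc_eval_direct_sum_eq_0 [OF A B disj this]
      obtain c where c: "\<forall>i\<in>insert j J. \<beta> i = c * \<alpha> i"
        using relation_unique [OF insert.hyps indep \<alpha>] zero(1) by (auto simp only: eval_comb)
      have "nc_eval B (comb \<beta>) *v w = (\<Sum>i\<in>insert j J. c *s (\<alpha> i *s (nc_eval B (f i) *v w)))"
        unfolding eval_comb vector_smult_assoc using c by (intro sum.cong refl) (metis (no_types))
      also have "\<dots> = c *s (nc_eval B (comb \<alpha>) *v w)"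
        unfolding eval_comb by (simp only: sum_cmul)
      finally have "c *s (nc_eval B (comb \<alpha>) *v w) = 0" using zero(2) by simp
      then have "c = 0" using nz by (auto simp: vec_eq_iff)
      then show "\<forall>i\<in>insert j J. \<beta> i = 0" using c by simp
    qed
    moreover have "supported_on S (\<lambda>i. A i + B i) (v + w)"
      using supported_on_sum [OF A B] T(1) by (simp add: Un_absorb2)
    ultimately show ?thesis by blast
  qed
qed

lemma length_le_nc_degree: "w \<in> Poly_Mapping.keys p \<Longrightarrow> length w \<le> nc_degree p"
  by (simp add: nc_degree_def)

text \<open>
  For \<open>m = 1\<close> the bound reads \<open>s > D/2\<close> and there is no slack. For \<open>m \<ge> 2\<close> the crude estimate \<open>d \<ge> m\<close>
  suffices.
\<close>

lemma size_bound:
  fixes m d D s :: nat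
  assumes "m \<ge> 1" "d = (m - 1) * fact m"
    and s: "real s > real ((d + 1) * (d + 2)) / 4 * (real m - 1 + real D) + real d / 2"
  shows "m * (D div 2 + 1) \<le> s"
proof (cases "m = 1")
  case True
  then have "real s > real D / 2" using s assms(2) by simp
  then show ?thesis using True by simp
next
  case False
  then have m: "m \<ge> 2" using assms(1) by simp
  have "1 * m \<le> (m - 1) * fact m"
    using m fact_ge_self [of m] by (intro mult_mono) auto
  then have d: "m \<le> d" using assms(2) by simp
  have "real (2 * m) \<le> real ((d + 1) * (d + 2))"
    using d m mult_mono [of m "d + 1" 2 "d + 2"] by (intro of_nat_mono) (simp add: mult.commute)
  then have C: "real m / 2 \<le> real ((d + 1) * (d + 2)) / 4" by simp
  have "real (m * (D div 2 + 1)) \<le> real m * (real D / 2 + 1)"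
    using of_nat_mono [of "D div 2 * 2" D, where 'a = real]
    by (simp only: of_nat_mult, intro mult_left_mono) auto
  also have "\<dots> = real m / 2 * (1 + real D) + real m / 2"
    by (simp add: field_simps)
  also have "\<dots> \<le> real ((d + 1) * (d + 2)) / 4 * (real m - 1 + real D) + real d / 2"
    using C d m by (intro add_mono mult_mono) auto
  also have "\<dots> < real s" by (rule s)
  finally show ?thesis by (simp only: of_nat_less_iff less_imp_le)
qed

theorem corollary3p8:
  fixes f :: "nat \<Rightarrow> ('n::finite, 'a::field) free_alg"
    and m d :: nat
  assumes "m \<ge> 1"
    and "d = (m - 1) * fact m"
    and "locally_dir_lin_dependent TYPE('s::finite) m f"
    and "real CARD('s) >
           real ((d + 1) * (d + 2)) / 4 * (real m - 1 + (\<Sum>j=1..m. real (nc_degree (f j))))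
           + real d / 2"
  shows "lin_dependent_family nc_scale m f"
proof (rule ccontr)
  assume "\<not> lin_dependent_family nc_scale m f"
  then have indep: "lin_independent_on nc_scale {1..m} f"
    by (simp add: lin_dependent_family_iff)
  define D where "D = (\<Sum>j=1..m. nc_degree (f j))"
  have deg: "length w \<le> D" if "j \<in> {1..m}" "w \<in> Poly_Mapping.keys (f j)" for j w
  proof -
    have "nc_degree (f j) \<le> D"
      unfolding D_def using that(1) by (intro member_le_sum) auto
    then show ?thesis using length_le_nc_degree [OF that(2)] by linarith
  qed
  have "m * (D div 2 + 1) \<le> CARD('s)"
    by (rule size_bound [OF assms(1,2)]) (use assms(4) in \<open>simp add: D_def\<close>)
  then have "card {1..m} * (D div 2 + 1) \<le> card (UNIV :: 's set)" by simp
  then have "\<exists>(A :: 'n \<Rightarrow> 'a ^ 's ^ 's) v. supported_on UNIV A v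
      \<and> lin_independent_on (*s) {1..m} (\<lambda>j. nc_eval A (f j) *v v)"
    by (intro independent_evaluation [where D = D] deg indep) auto
  then obtain A :: "'n \<Rightarrow> 'a ^ 's ^ 's" and v
    where "lin_independent_on (*s) {1..m} (\<lambda>j. nc_eval A (f j) *v v)" by blast
  then show False
    using assms(3) unfolding locally_dir_lin_dependent_def lin_dependent_family_iff by blast
qed

end
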